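(* Let $H>2$ be an integer and let $\alpha,\mu,\delta>0$ be real numbers with $(\alpha+\mu)\delta<1$. With $u^*(p,\gamma)$ as defined in the context, there is a unique threshold $\overline\gamma_L$ for the risk aversion $\gamma\ge 1$ that governs the transition from probabilistic to no sniping, i.e. a unique $\overline\gamma_L>1$ such that $$\left.\frac{\partial u^*}{\partial p}(p,\gamma)\right|_{p=0}>0 \ \text{ for } 1\le\gamma<\overline\gamma_L,\qquad \left.\frac{\partial u^*}{\partial p}(p,\gamma)\right|_{p=0}=0 \ \text{ for } \gamma=\overline\gamma_L,\qquad \left.\frac{\partial u^*}{\partial p}(p,\gamma)\right|_{p=0}<0 \ \text{ for } \gamma>\overline\gamma_L .$$ Specifically, $$\overline\gamma_L = 1+\sqrt{\frac{(1-\overline\mu)\,Z}{\overline\alpha\,\overline\theta}},\qquad\text{where } Z=1+\overline\mu-\beta(1-\overline\mu).$$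
   Context: Parameters: an integer $H>2$ (number of high-frequency traders), real $\alpha,\mu,\delta>0$ (news arrival rate, liquidity-trader arrival rate, exchange latency) with $(\alpha+\mu)\delta<1$, and risk aversion $\gamma\ge 1$. Put $$\overline\alpha=\frac{\alpha\delta}{2},\quad \overline\mu=\frac{\mu\delta}{2},\quad \beta=\frac{\alpha}{\alpha+\mu},\quad q=\gamma-1,\quad m=1-\overline\mu,\quad \overline\theta=\frac{2\,\overline\alpha\,\overline\mu}{\overline\alpha+\overline\mu}.$$ For a sniping probability $p\in(0,1]$ define $$h(p)=\frac{(1-p)^H-(1-Hp)}{Hp},\qquad g(p)=\frac{h(p)}{(H-1)p};$$ both are polynomials in $p$ (after cancellation), and are extended accordingly to $p=0$ (so $h(0)=0$, $g(0)=\tfrac12$) and to all real $p$, so that derivatives at the endpoints make sense. Define $$A(p,\gamma)=m\beta\,p\,g(p),\qquad B(p,\gamma)=-\overline\alpha\, q\,\beta\, p\,g(p),$$ $$C(p,\gamma)=-\bigl\{q\overline\theta+\beta(m\gamma-\overline\mu q)\,h(p)\bigr\},\qquad D(p,\gamma)=(1+\overline\mu)-\beta\bigl(m+\overline\alpha q\,h(p)\bigr).$$ As functions of the spread $s\in[0,1]$, the expected utilities of a bandit and of the market maker are $A(1-s)+Bs$ and $C(1-s)+Ds$. With $$N=AD-BC,\qquad Q=(A-C)+(D-B),$$ the utility at the intersection of these two lines (the point of indifference) is $u^*(p,\gamma)=N(p,\gamma)/Q(p,\gamma)$. The case $0<p<1$ is called probabilistic sniping and $p=0$ no sniping. The transition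 from probabilistic to no sniping is defined as the change of sign of $\partial u^*/\partial p$ at $p=0$ from positive (probabilistic sniping) to negative (no sniping) as $\gamma$ increases. *)

theory Defs
  imports "HOL-Analysis.Analysis" "HOL-Computational_Algebra.Polynomial"
begin

text \<open>
  Throughout, \<open>H\<close> is the number of high-frequency traders, \<open>\<alpha>\<close> the news arrival rate,
  \<open>\<mu>\<close> the arrival rate of liquidity traders, \<open>\<delta>\<close> the exchange latency, \<open>\<gamma>\<close> the risk
  aversion, and \<open>p\<close> the sniping probability.
\<close>

definition alpha_bar :: "real \<Rightarrow> real \<Rightarrow> real" where
  "alpha_bar \<alpha> \<delta> = \<alpha> * \<delta> / 2"

definition mu_bar :: "real \<Rightarrow> real \<Rightarrow> real" where
  "mu_bar \<mu> \<delta> = \<mu> * \<delta> / 2"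

definition news_frac :: "real \<Rightarrow> real \<Rightarrow> real" where
  "news_frac \<alpha> \<mu> = \<alpha> / (\<alpha> + \<mu>)"

definition theta_bar :: "real \<Rightarrow> real \<Rightarrow> real \<Rightarrow> real" where
  "theta_bar \<alpha> \<mu> \<delta> =
     2 * alpha_bar \<alpha> \<delta> * mu_bar \<mu> \<delta> / (alpha_bar \<alpha> \<delta> + mu_bar \<mu> \<delta>)"

text \<open>
  The quotients \<open>h(p) = ((1 - p)^H - (1 - H p)) / (H p)\<close> and \<open>g(p) = h(p) / ((H - 1) p)\<close> are
  polynomials in \<open>p\<close> after cancellation. The division is therefore carried out in \<open>real poly\<close>,
  which gives the intended values at \<open>p = 0\<close>; the lemmas below show that both divisions are exact.
\<close>

definition h_poly :: "nat \<Rightarrow> real poly" where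
  "h_poly H = ([:1, -1:] ^ H - [:1, - real H:]) div [:0, real H:]"

definition g_poly :: "nat \<Rightarrow> real poly" where
  "g_poly H = h_poly H div [:0, real H - 1:]"

definition h_fun :: "nat \<Rightarrow> real \<Rightarrow> real" where
  "h_fun H p = poly (h_poly H) p"

definition g_fun :: "nat \<Rightarrow> real \<Rightarrow> real" where
  "g_fun H p = poly (g_poly H) p"

definition A_util :: "nat \<Rightarrow> real \<Rightarrow> real \<Rightarrow> real \<Rightarrow> real \<Rightarrow> real \<Rightarrow> real" where
  "A_util H \<alpha> \<mu> \<delta> p \<gamma> = (1 - mu_bar \<mu> \<delta>) * news_frac \<alpha> \<mu> * p * g_fun H p"

definition B_util :: "nat \<Rightarrow> real \<Rightarrow> real \<Rightarrow> real \<Rightarrow> real \<Rightarrow> real \<Rightarrow> real" where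
  "B_util H \<alpha> \<mu> \<delta> p \<gamma> = - alpha_bar \<alpha> \<delta> * (\<gamma> - 1) * news_frac \<alpha> \<mu> * p * g_fun H p"

definition C_util :: "nat \<Rightarrow> real \<Rightarrow> real \<Rightarrow> real \<Rightarrow> real \<Rightarrow> real \<Rightarrow> real" where
  "C_util H \<alpha> \<mu> \<delta> p \<gamma> =
     - ((\<gamma> - 1) * theta_bar \<alpha> \<mu> \<delta>
        + news_frac \<alpha> \<mu> * ((1 - mu_bar \<mu> \<delta>) * \<gamma> - mu_bar \<mu> \<delta> * (\<gamma> - 1)) * h_fun H p)"

definition D_util :: "nat \<Rightarrow> real \<Rightarrow> real \<Rightarrow> real \<Rightarrow> real \<Rightarrow> real \<Rightarrow> real" where
  "D_util H \<alpha> \<mu> \<delta> p \<gamma> =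
     (1 + mu_bar \<mu> \<delta>)
     - news_frac \<alpha> \<mu> * ((1 - mu_bar \<mu> \<delta>) + alpha_bar \<alpha> \<delta> * (\<gamma> - 1) * h_fun H p)"

definition N_util :: "nat \<Rightarrow> real \<Rightarrow> real \<Rightarrow> real \<Rightarrow> real \<Rightarrow> real \<Rightarrow> real" where
  "N_util H \<alpha> \<mu> \<delta> p \<gamma> =
     A_util H \<alpha> \<mu> \<delta> p \<gamma> * D_util H \<alpha> \<mu> \<delta> p \<gamma> - B_util H \<alpha> \<mu> \<delta> p \<gamma> * C_util H \<alpha> \<mu> \<delta> p \<gamma>"

definition Q_util :: "nat \<Rightarrow> real \<Rightarrow> real \<Rightarrow> real \<Rightarrow> real \<Rightarrow> real \<Rightarrow> real" where
  "Q_util H \<alpha> \<mu> \<delta> p \<gamma> =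
     (A_util H \<alpha> \<mu> \<delta> p \<gamma> - C_util H \<alpha> \<mu> \<delta> p \<gamma>) + (D_util H \<alpha> \<mu> \<delta> p \<gamma> - B_util H \<alpha> \<mu> \<delta> p \<gamma>)"

definition u_star :: "nat \<Rightarrow> real \<Rightarrow> real \<Rightarrow> real \<Rightarrow> real \<Rightarrow> real \<Rightarrow> real" where
  "u_star H \<alpha> \<mu> \<delta> p \<gamma> = N_util H \<alpha> \<mu> \<delta> p \<gamma> / Q_util H \<alpha> \<mu> \<delta> p \<gamma>"

text \<open>
  \<open>deriv\<close> below is the two-sided derivative at \<open>0\<close>, which makes sense because \<open>h\<close> and \<open>g\<close> are
  extended to all real arguments.
\<close>

definition sniping_threshold :: "nat \<Rightarrow> real \<Rightarrow> real \<Rightarrow> real \<Rightarrow> real \<Rightarrow> bool" where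
  "sniping_threshold H \<alpha> \<mu> \<delta> \<gamma>L \<longleftrightarrow>
     \<gamma>L > 1 \<and>
     (\<forall>\<gamma>. 1 \<le> \<gamma> \<and> \<gamma> < \<gamma>L \<longrightarrow> deriv (\<lambda>p. u_star H \<alpha> \<mu> \<delta> p \<gamma>) 0 > 0) \<and>
     deriv (\<lambda>p. u_star H \<alpha> \<mu> \<delta> p \<gamma>L) 0 = 0 \<and>
     (\<forall>\<gamma>. \<gamma> > \<gamma>L \<longrightarrow> deriv (\<lambda>p. u_star H \<alpha> \<mu> \<delta> p \<gamma>) 0 < 0)"

lemma h_numerator_dvd:
  "[:0, 1:] ^ 2 dvd [:1, -1:] ^ H - [:1, - real H:]"
proof (induction H)
  case 0
  then show ?case by (simp add: one_pCons)
next
  case (Suc H)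
  have "[:1, -1:] ^ Suc H - [:1, - real (Suc H):] =
        [:1, -1:] * ([:1, -1:] ^ H - [:1, - real H:]) + [:0, 1:] ^ 2 * [:real H:]"
    by (simp add: power2_eq_square algebra_simps)
  then show ?case
    using Suc by (simp only: dvd_add dvd_mult dvd_triv_left)
qed

lemma h_poly_exact:
  assumes "H > 0"
  shows "[:0, real H:] * h_poly H = [:1, -1:] ^ H - [:1, - real H:]"
proof -
  have "[:0, 1:] ^ 2 = [:0, real H:] * [:0, 1 / real H:]"
    using assms by (simp add: power2_eq_square)
  then have "[:0, real H:] dvd [:0, 1:] ^ 2"
    by (rule dvdI)
  then have "[:0, real H:] dvd [:1, -1:] ^ H - [:1, - real H:]"
    using h_numerator_dvd by (rule dvd_trans)
  then show ?thesis
    unfolding h_poly_def by (rule dvd_mult_div_cancel)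
qed

lemma g_poly_exact:
  assumes "H > 1"
  shows "[:0, real H - 1:] * g_poly H = h_poly H"
proof -
  obtain r where r: "[:1, -1:] ^ H - [:1, - real H:] = [:0, 1:] ^ 2 * r"
    using h_numerator_dvd by (rule dvdE)
  have eq: "[:0, 1:] ^ 2 = [:0, real H:] * ([:0, real H - 1:] * [:1 / (real H * (real H - 1)):])"
    using assms by (simp add: power2_eq_square)
  have "[:0, real H:] * h_poly H =
        [:0, real H:] * ([:0, real H - 1:] * ([:1 / (real H * (real H - 1)):] * r))"
    using assms by (simp only: h_poly_exact r eq mult.assoc)
  moreover have "[:0, real H:] \<noteq> 0"
    using assms by simp
  ultimately have "h_poly H = [:0, real H - 1:] * ([:1 / (real H * (real H - 1)):] * r)"
    by (rule mult_left_cancel[THEN iffD1, rotated])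
  then have "[:0, real H - 1:] dvd h_poly H"
    by (rule dvdI)
  then show ?thesis
    unfolding g_poly_def by (rule dvd_mult_div_cancel)
qed

lemma h_fun_eq:
  assumes "H > 0" "p \<noteq> 0"
  shows "h_fun H p = ((1 - p) ^ H - (1 - real H * p)) / (real H * p)"
  using arg_cong[OF h_poly_exact[OF assms(1)], of "\<lambda>r. poly r p"] assms
  by (simp add: h_fun_def poly_power field_simps)

lemma g_fun_eq:
  assumes "H > 1" "p \<noteq> 0"
  shows "g_fun H p = h_fun H p / ((real H - 1) * p)"
  using arg_cong[OF g_poly_exact[OF assms(1)], of "\<lambda>r. poly r p"] assms
  by (simp add: g_fun_def h_fun_def field_simps)

text \<open>\<open>u_star\<close> is the common value of the two utility lines where they cross.\<close>

lemma u_star_intersection: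
  assumes "Q_util H \<alpha> \<mu> \<delta> p \<gamma> \<noteq> 0"
    and "A_util H \<alpha> \<mu> \<delta> p \<gamma> * (1 - s) + B_util H \<alpha> \<mu> \<delta> p \<gamma> * s =
         C_util H \<alpha> \<mu> \<delta> p \<gamma> * (1 - s) + D_util H \<alpha> \<mu> \<delta> p \<gamma> * s"
  shows "A_util H \<alpha> \<mu> \<delta> p \<gamma> * (1 - s) + B_util H \<alpha> \<mu> \<delta> p \<gamma> * s = u_star H \<alpha> \<mu> \<delta> p \<gamma>"
proof -
  let ?A = "A_util H \<alpha> \<mu> \<delta> p \<gamma>" and ?B = "B_util H \<alpha> \<mu> \<delta> p \<gamma>"
  let ?C = "C_util H \<alpha> \<mu> \<delta> p \<gamma>" and ?D = "D_util H \<alpha> \<mu> \<delta> p \<gamma>"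
  let ?Q = "Q_util H \<alpha> \<mu> \<delta> p \<gamma>"
  have sQ: "s * ?Q = ?A - ?C"
    using assms(2) unfolding Q_util_def by (simp add: algebra_simps)
  have "(?A * (1 - s) + ?B * s) * ?Q = ?A * ?Q + (?B - ?A) * (s * ?Q)"
    by (simp add: algebra_simps)
  also have "\<dots> = N_util H \<alpha> \<mu> \<delta> p \<gamma>"
    unfolding sQ by (simp add: Q_util_def N_util_def algebra_simps)
  finally show ?thesis
    using assms(1) by (simp add: u_star_def eq_divide_eq)
qed

end

theory Submission
  imports Defs
begin

text \<open>
  The polynomials \<open>A\<close> and \<open>B\<close> both carry the factor \<open>p g(p)\<close>, hence \<open>u\<^sup>* = p F(p)\<close> with \<open>F\<close>
  continuous at \<open>0\<close>, and the derivative at \<open>0\<close> is just \<open>F(0)\<close>. With \<open>h(0) = 0\<close> and \<open>g(0) = 1/2\<close>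
  this is a positive multiple of \<open>m Z - \<alpha>\<theta> (\<gamma> - 1)\<^sup>2\<close> (the barred \<open>\<alpha>\<close> and \<open>\<theta>\<close>), whose sign
  changes exactly once for \<open>\<gamma> \<ge> 1\<close>.
\<close>

lemma h_fun_0:
  assumes "H > 1"
  shows "h_fun H 0 = 0"
proof -
  have "poly (h_poly H) 0 = poly ([:0, real H - 1:] * g_poly H) 0"
    using assms by (simp only: g_poly_exact)
  then show ?thesis by (simp add: h_fun_def)
qed

text \<open>Second derivatives at 0 of the exact division identity are compared. The factor
  \<open>H (H - 1) p^2\<close> in front of \<open>g_poly\<close> leaves
  \<open>2 H (H - 1) g(0)\<close>. On the other side the linear part drops out and
  \<open>(1 - p)^H\<close> contributes \<open>H (H - 1)\<close>.\<close>

lemma g_fun_0: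
  assumes "H > 1"
  shows "g_fun H 0 = 1 / 2"
proof -
  \<comment> \<open>Two explicit successors let \<open>pderiv_power_Suc\<close> apply to both
    derivatives.\<close>
  obtain n where n: "H = Suc (Suc n)"
    using assms by (metis less_imp_Suc_add One_nat_def add_Suc)
  have eq: "[:0, real H:] * ([:0, real H - 1:] * g_poly H) = [:1, -1:] ^ H - [:1, - real H:]"
    using assms by (simp only: g_poly_exact h_poly_exact)
  have "poly (pderiv (pderiv ([:0, real H:] * ([:0, real H - 1:] * g_poly H)))) 0
      = 2 * real H * (real H - 1) * g_fun H 0"
    by (simp add: pderiv_mult pderiv_pCons pderiv_add g_fun_def algebra_simps)
  moreover have "poly (pderiv (pderiv ([:1, -1:] ^ H - [:1, - real H:]))) 0
      = real H * (real H - 1)"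
    unfolding n
    by (simp add: pderiv_power_Suc pderiv_diff pderiv_mult pderiv_smult pderiv_pCons
        del: power_Suc) (simp add: poly_power algebra_simps)
  ultimately have "real H * (real H - 1) * (2 * g_fun H 0) = real H * (real H - 1) * 1"
    using eq by simp
  then show ?thesis
    using assms by (simp only: mult_cancel_left) simp
qed

lemma isCont_h_fun: "isCont (h_fun H) p"
  unfolding h_fun_def by simp

lemma isCont_g_fun: "isCont (g_fun H) p"
  unfolding g_fun_def by simp

lemma u_star_has_derivative_at_0:
  fixes \<alpha> \<mu> \<delta> \<gamma> :: real
  defines "Z \<equiv> 1 + mu_bar \<mu> \<delta> - news_frac \<alpha> \<mu> * (1 - mu_bar \<mu> \<delta>)"
  assumes "H > 1" and Q: "(\<gamma> - 1) * theta_bar \<alpha> \<mu> \<delta> + Z \<noteq> 0"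
  shows "((\<lambda>p. u_star H \<alpha> \<mu> \<delta> p \<gamma>) has_real_derivative
           news_frac \<alpha> \<mu> / 2
           * ((1 - mu_bar \<mu> \<delta>) * Z - alpha_bar \<alpha> \<delta> * theta_bar \<alpha> \<mu> \<delta> * (\<gamma> - 1)\<^sup>2)
           / ((\<gamma> - 1) * theta_bar \<alpha> \<mu> \<delta> + Z)) (at 0)"
proof -
  \<comment> \<open>\<open>F\<close> is the slope function for Caratheodory's criterion
    \<open>CARAT_DERIV\<close>: the common factor \<open>p\<close> of \<open>A\<close> and
    \<open>B\<close> is removed from \<open>A D - B C\<close>, and the rest is divided by
    \<open>Q_util\<close>.\<close>
  define F where "F p = g_fun H p * news_frac \<alpha> \<mu>
      * ((1 - mu_bar \<mu> \<delta>) * D_util H \<alpha> \<mu> \<delta> p \<gamma> + alpha_bar \<alpha> \<delta> * (\<gamma> - 1) * C_util H \<alpha> \<mu> \<delta> p \<gamma>)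
      / Q_util H \<alpha> \<mu> \<delta> p \<gamma>" for p
  have h0: "h_fun H 0 = 0" and g0: "g_fun H 0 = 1 / 2"
    using assms(2) by (rule h_fun_0, rule g_fun_0)
  have Q0: "Q_util H \<alpha> \<mu> \<delta> 0 \<gamma> = (\<gamma> - 1) * theta_bar \<alpha> \<mu> \<delta> + Z"
    by (simp add: Q_util_def A_util_def B_util_def C_util_def D_util_def h0 Z_def)
  have "isCont F 0"
    using Q unfolding F_def Q0[symmetric] unfolding Q_util_def A_util_def B_util_def C_util_def D_util_def
    by (intro continuous_intros isCont_h_fun isCont_g_fun)
  \<comment> \<open>The identity holds for every \<open>p\<close>, even at zeros of
    \<open>Q_util\<close>, where both quotients are 0 by convention. The value of
    \<open>u_star\<close> at 0 vanishes because \<open>A\<close> and \<open>B\<close> do.\<close>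
  moreover have "u_star H \<alpha> \<mu> \<delta> p \<gamma> - u_star H \<alpha> \<mu> \<delta> 0 \<gamma> = F p * (p - 0)" for p
    by (simp add: u_star_def N_util_def A_util_def B_util_def F_def algebra_simps
        add_divide_distrib diff_divide_distrib)
  moreover have "F 0 = news_frac \<alpha> \<mu> / 2
           * ((1 - mu_bar \<mu> \<delta>) * Z - alpha_bar \<alpha> \<delta> * theta_bar \<alpha> \<mu> \<delta> * (\<gamma> - 1)\<^sup>2)
           / ((\<gamma> - 1) * theta_bar \<alpha> \<mu> \<delta> + Z)"
    unfolding F_def Q0
    by (simp add: g0 h0 C_util_def D_util_def Z_def power2_eq_square algebra_simps)
  ultimately show ?thesis
    unfolding CARAT_DERIV by blast
qed

text \<open>If one threshold were smaller, the derivative at the larger one would have to be both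
  negative and zero.\<close>

lemma sniping_threshold_unique:
  assumes "sniping_threshold H \<alpha> \<mu> \<delta> x" and "sniping_threshold H \<alpha> \<mu> \<delta> y"
  shows "x = y"
  using assms unfolding sniping_threshold_def
  by (metis less_eq_real_def less_irrefl linorder_neqE_linordered_idom)

theorem proposition2:
  fixes H :: nat and \<alpha> \<mu> \<delta> :: real
  assumes "H > 2" and "\<alpha> > 0" and "\<mu> > 0" and "\<delta> > 0" and "(\<alpha> + \<mu>) * \<delta> < 1"
  shows "(\<forall>\<gamma>\<ge>1. (\<lambda>p. u_star H \<alpha> \<mu> \<delta> p \<gamma>) differentiable (at 0)) \<and>
         (\<exists>!\<gamma>L. sniping_threshold H \<alpha> \<mu> \<delta> \<gamma>L) \<and>
         (let Z = 1 + mu_bar \<mu> \<delta> - news_frac \<alpha> \<mu> * (1 - mu_bar \<mu> \<delta>)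
          in sniping_threshold H \<alpha> \<mu> \<delta>
               (1 + sqrt ((1 - mu_bar \<mu> \<delta>) * Z / (alpha_bar \<alpha> \<delta> * theta_bar \<alpha> \<mu> \<delta>))))"
proof -
  define m where "m = 1 - mu_bar \<mu> \<delta>"
  define \<beta> where "\<beta> = news_frac \<alpha> \<mu>"
  define \<theta> where "\<theta> = theta_bar \<alpha> \<mu> \<delta>"
  define a where "a = alpha_bar \<alpha> \<delta>"
  define Z where "Z = 1 + mu_bar \<mu> \<delta> - \<beta> * m"
  \<comment> \<open>\<open>r\<close> is the value of \<gamma> - 1 at which the numerator of the
    derivative vanishes.\<close>
  define r where "r = sqrt (m * Z / (a * \<theta>))"
  have "\<mu> * \<delta> < 1" and \<mu>\<delta>: "\<mu> * \<delta> > 0"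
    using assms(5) mult_pos_pos[OF \<open>\<alpha> > 0\<close> \<open>\<delta> > 0\<close>] mult_pos_pos[OF \<open>\<mu> > 0\<close> \<open>\<delta> > 0\<close>]
    by (simp_all add: distrib_right)
  then have m: "0 < m" "m < 1"
    unfolding m_def mu_bar_def by linarith+
  have \<beta>: "0 < \<beta>" "\<beta> < 1"
    using assms by (simp_all add: \<beta>_def news_frac_def)
  have a: "a > 0" and \<theta>: "\<theta> > 0"
    using assms by (simp_all add: a_def \<theta>_def theta_bar_def alpha_bar_def mu_bar_def add_pos_pos)
  \<comment> \<open>This makes \<open>Z\<close> larger than \<open>mu_bar\<close>, hence positive,
    so that \<open>r\<close> is the root of a positive number.\<close>
  have "\<beta> * m < 1"
    using mult_strict_mono[of \<beta> 1 m 1] m \<beta> by simp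
  then have Z: "Z > 0"
    using \<mu>\<delta> unfolding Z_def mu_bar_def by linarith
  have r: "r > 0" and r2: "m * Z = a * \<theta> * r\<^sup>2"
    using m Z a \<theta> by (simp_all add: r_def)
  have denom: "(\<gamma> - 1) * \<theta> + Z > 0" if "\<gamma> \<ge> 1" for \<gamma>
    using that \<theta> Z by (simp add: add_nonneg_pos)
  have deriv: "((\<lambda>p. u_star H \<alpha> \<mu> \<delta> p \<gamma>) has_real_derivative
      \<beta> / 2 * (m * Z - a * \<theta> * (\<gamma> - 1)\<^sup>2) / ((\<gamma> - 1) * \<theta> + Z)) (at 0)" if "\<gamma> \<ge> 1" for \<gamma>
    using u_star_has_derivative_at_0[of H \<gamma> \<alpha> \<mu> \<delta>] denom[OF that] \<open>H > 2\<close>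
    by (simp add: m_def \<beta>_def \<theta>_def a_def Z_def)
  \<comment> \<open>Replacing \<open>m * Z\<close> by \<open>r2\<close> leaves a positive
    coefficient times a difference of squares, so the sign depends only on comparing \<gamma> - 1
    with \<open>r\<close>.\<close>
  have deriv_eq: "deriv (\<lambda>p. u_star H \<alpha> \<mu> \<delta> p \<gamma>) 0 =
      \<beta> / 2 * (a * \<theta>) / ((\<gamma> - 1) * \<theta> + Z) * (r\<^sup>2 - (\<gamma> - 1)\<^sup>2)" if "\<gamma> \<ge> 1" for \<gamma>
    unfolding DERIV_imp_deriv[OF deriv[OF that]] r2 by (simp add: algebra_simps diff_divide_distrib)
  have coeff: "\<beta> / 2 * (a * \<theta>) / ((\<gamma> - 1) * \<theta> + Z) > 0" if "\<gamma> \<ge> 1" for \<gamma>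
    using denom[OF that] \<beta> a \<theta> by simp
  have threshold: "sniping_threshold H \<alpha> \<mu> \<delta> (1 + r)"
    unfolding sniping_threshold_def
  proof (intro conjI allI impI)
    show "1 + r > 1" using r by simp
    show "deriv (\<lambda>p. u_star H \<alpha> \<mu> \<delta> p (1 + r)) 0 = 0"
      using r by (simp add: deriv_eq)
  next
    fix \<gamma> assume \<gamma>: "1 \<le> \<gamma> \<and> \<gamma> < 1 + r"
    \<comment> \<open>Squaring preserves the order because \<gamma> \<ge> 1 makes \<gamma> - 1
      nonnegative.\<close>
    then have "(\<gamma> - 1)\<^sup>2 < r\<^sup>2" by (intro power_strict_mono) auto
    then show "deriv (\<lambda>p. u_star H \<alpha> \<mu> \<delta> p \<gamma>) 0 > 0"
      using \<gamma> coeff[of \<gamma>] by (simp only: deriv_eq) (simp only: mult_pos_pos diff_gt_0_iff_gt)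
  next
    fix \<gamma> assume \<gamma>: "\<gamma> > 1 + r"
    then have "r\<^sup>2 < (\<gamma> - 1)\<^sup>2" using r by (intro power_strict_mono) auto
    then show "deriv (\<lambda>p. u_star H \<alpha> \<mu> \<delta> p \<gamma>) 0 < 0"
      using \<gamma> r coeff[of \<gamma>] deriv_eq[of \<gamma>] by (simp only: mult_pos_neg diff_less_0_iff_less)
  qed
  \<comment> \<open>Since \<open>deriv\<close> is a total operator, this ensures that the signs in
    \<open>sniping_threshold\<close> are those of a genuine derivative.\<close>
  have "\<forall>\<gamma>\<ge>1. (\<lambda>p. u_star H \<alpha> \<mu> \<delta> p \<gamma>) differentiable (at 0)"
    using deriv real_differentiable_def by blast
  moreover have "\<exists>!\<gamma>L. sniping_threshold H \<alpha> \<mu> \<delta> \<gamma>L"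
    using threshold sniping_threshold_unique by blast
  ultimately show ?thesis
    using threshold by (simp add: Let_def r_def Z_def a_def \<theta>_def \<beta>_def m_def)
qed

end
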